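(* Let $G$ be a Polish group and let $m$ be a continuous partial action of $G$ on a Polish space $X$. Then the following assertions are equivalent. (1) The orbit equivalence relation $E_G^p$ is $G_\delta$ (as a subset of $X\times X$). (2) $G^x\cdot x$ is $G_\delta$ in $X$ for every $x\in X$. (3) $X/E_G^p$ is $T_0$, that is, $\overline{\{a\}}\neq\overline{\{b\}}$ for any $a,b\in X/E_G^p$ with $a\neq b$.
   Context: A partial action of a group $G$ (identity $1$) on a set $X$ is a partially defined function $m\colon G\times X\to X$, $(g,x)\mapsto g\cdot x$, such that, writing $\exists\, g\cdot x$ for "$(g,x)$ is in the domain of $m$", for all $g,h\in G$ and $x\in X$: (PA1) $\exists\, g\cdot x$ implies $\exists\, g^{-1}\cdot(g\cdot x)$ and $g^{-1}\cdot(g\cdot x)=x$; (PA2) $\exists\, g\cdot(h\cdot x)$ implies $\exists\,(gh)\cdot x$ and $g\cdot(h\cdot x)=(gh)\cdot x$; (PA3) $\exists\, 1\cdot x$ and $1\cdot x=x$. Notation: $G*X=\{(g,x)\in G\times X: \exists\, g\cdot x\}$ is the domain of $m$; $X_{g^{-1}}=\{x\in X:\exists\, g\cdot x\}$; $m_g\colon X_{g^{-1}}\to X_g$, $x\mapsto g\cdot x$ (a bijection); $G^x=\{g\in G:\exists\, g\cdot x\}$; the orbit of $x$ is $G^x\cdot x=\{g\cdot x: g\in G^x\}$. When $G$ is a topological group and $X$ a topological space, $m$ is a continuous partial action if each $X_g$ is open in $X$, each $m_g\colon X_{g^{-1}}\to X_g$ is a homeomorphism, and $m\colon G*X\to X$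 is continuous, where $G*X$ has the topology induced from the product $G\times X$. The orbit equivalence relation $E_G^p$ on $X$ is defined by: $x\,E_G^p\,y$ if and only if there is $g\in G$ with $\exists\, g\cdot x$ and $g\cdot x=y$. The set of equivalence classes $X/E_G^p$ carries the quotient topology. A Polish space is a separable completely metrizable topological space; a Polish group is a topological group whose topology is Polish. *)

theory Defs
  imports "HOL-Analysis.Analysis" "HOL-Algebra.Group"
begin

definition Polish_space :: "'a topology \<Rightarrow> bool" where
  "Polish_space X \<longleftrightarrow> completely_metrizable_space X \<and> separable_space X"

locale topological_group = group G for G (structure) +
  fixes T :: "'g topology"
  assumes topspace_eq_carrier: "topspace T = carrier G"
    and continuous_mult: "continuous_map (prod_topology T T) T (\<lambda>(g, h). g \<otimes> h)"
    and continuous_inv: "continuous_map T T (\<lambda>g. inv g)"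

locale polish_group = topological_group +
  assumes Polish: "Polish_space T"

text \<open>
  A partially defined map \<open>G \<times> X \<rightarrow> X\<close> is a function \<open>act\<close> with option values, where
  \<open>act g x = Some y\<close> means that \<open>g \<cdot> x\<close> is defined and equal to \<open>y\<close>. The first axiom makes
  \<open>act\<close> undefined outside the carriers.
\<close>

locale partial_action = group G for G (structure) +
  fixes X :: "'x set" and act :: "'g \<Rightarrow> 'x \<rightharpoonup> 'x"
  assumes act_carrier: "act g x = Some y \<Longrightarrow> g \<in> carrier G \<and> x \<in> X \<and> y \<in> X"
    and PA1: "act g x = Some y \<Longrightarrow> act (inv g) y = Some x"
    and PA2: "act h x = Some y \<Longrightarrow> act g y = Some z \<Longrightarrow> act (g \<otimes> h) x = Some z"
    and PA3: "x \<in> X \<Longrightarrow> act \<one> x = Some x"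

text \<open>The domain \<open>G * X\<close>.\<close>

definition pa_domain :: "('g \<Rightarrow> 'x \<rightharpoonup> 'x) \<Rightarrow> ('g \<times> 'x) set" where
  "pa_domain act = {(g, x). act g x \<noteq> None}"

text \<open>The set \<open>X\<^sub>g\<close>: the points \<open>x\<close> such that \<open>g\<inverse> \<cdot> x\<close> (not \<open>g \<cdot> x\<close>) is defined.\<close>

definition pa_set :: "('g, 'm) monoid_scheme \<Rightarrow> ('g \<Rightarrow> 'x \<rightharpoonup> 'x) \<Rightarrow> 'g \<Rightarrow> 'x set" where
  "pa_set G act g = {x. act (inv\<^bsub>G\<^esub> g) x \<noteq> None}"

text \<open>The set \<open>G\<^sup>x\<close> and the orbit \<open>G\<^sup>x \<cdot> x\<close>.\<close>

definition pa_elements :: "('g, 'm) monoid_scheme \<Rightarrow> ('g \<Rightarrow> 'x \<rightharpoonup> 'x) \<Rightarrow> 'x \<Rightarrow> 'g set" where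
  "pa_elements G act x = {g \<in> carrier G. act g x \<noteq> None}"

definition pa_orbit :: "('g, 'm) monoid_scheme \<Rightarrow> ('g \<Rightarrow> 'x \<rightharpoonup> 'x) \<Rightarrow> 'x \<Rightarrow> 'x set" where
  "pa_orbit G act x = (\<lambda>g. the (act g x)) ` pa_elements G act x"

definition pa_orbit_rel ::
    "('g, 'm) monoid_scheme \<Rightarrow> 'x set \<Rightarrow> ('g \<Rightarrow> 'x \<rightharpoonup> 'x) \<Rightarrow> ('x \<times> 'x) set" where
  "pa_orbit_rel G X act = {(x, y) \<in> X \<times> X. \<exists>g \<in> carrier G. act g x = Some y}"

locale continuous_partial_action =
  topological_group G T + partial_action G "topspace X" act
  for G (structure) and T :: "'g topology" and X :: "'x topology" and act +
  assumes open_pa_set: "g \<in> carrier G \<Longrightarrow> openin X (pa_set G act g)"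
    and homeomorphic_act: "g \<in> carrier G \<Longrightarrow>
      homeomorphic_map (subtopology X (pa_set G act (inv g))) (subtopology X (pa_set G act g))
        (\<lambda>x. the (act g x))"
    and continuous_act:
      "continuous_map (subtopology (prod_topology T X) (pa_domain act)) X
        (\<lambda>(g, x). the (act g x))"

definition quotient_topology :: "'a topology \<Rightarrow> ('a \<times> 'a) set \<Rightarrow> 'a set topology" where
  "quotient_topology X R =
    topology (\<lambda>U. U \<subseteq> topspace X // R \<and> openin X {x \<in> topspace X. R `` {x} \<in> U})"

lemma openin_quotient_topology:
  "openin (quotient_topology X R) U \<longleftrightarrow>
    U \<subseteq> topspace X // R \<and> openin X {x \<in> topspace X. R `` {x} \<in> U}"
proof -
  let ?P = "\<lambda>U. U \<subseteq> topspace X // R \<and> openin X {x \<in> topspace X. R `` {x} \<in> U}"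
  have "istopology ?P"
    unfolding istopology_def
  proof (intro conjI allI impI)
    fix S T assume "?P S" "?P T"
    moreover have "{x \<in> topspace X. R `` {x} \<in> S \<inter> T} =
      {x \<in> topspace X. R `` {x} \<in> S} \<inter> {x \<in> topspace X. R `` {x} \<in> T}" by auto
    ultimately show "S \<inter> T \<subseteq> topspace X // R"
      "openin X {x \<in> topspace X. R `` {x} \<in> S \<inter> T}" by auto
  next
    fix \<K> assume "\<forall>K\<in>\<K>. ?P K"
    moreover have "{x \<in> topspace X. R `` {x} \<in> \<Union>\<K>} =
      (\<Union>K\<in>\<K>. {x \<in> topspace X. R `` {x} \<in> K})" by auto
    ultimately show "\<Union>\<K> \<subseteq> topspace X // R"
      "openin X {x \<in> topspace X. R `` {x} \<in> \<Union>\<K>}" by auto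
  qed
  then show ?thesis
    by (simp add: quotient_topology_def)
qed

lemma topspace_quotient_topology: "topspace (quotient_topology X R) = topspace X // R"
proof -
  have "{x \<in> topspace X. R `` {x} \<in> topspace X // R} = topspace X"
    by (auto simp: quotient_def)
  then have "openin (quotient_topology X R) (topspace X // R)"
    by (simp add: openin_quotient_topology)
  then show ?thesis
    by (meson openin_quotient_topology openin_subset openin_topspace subset_antisym)
qed

lemma quotient_map_quotient_topology:
  "quotient_map X (quotient_topology X R) (\<lambda>x. R `` {x})"
  by (auto simp: quotient_map_def topspace_quotient_topology openin_quotient_topology quotient_def)

lemma (in partial_action) equiv_pa_orbit_rel: "equiv X (pa_orbit_rel G X act)"
proof (rule equivI)
  show "pa_orbit_rel G X act \<subseteq> X \<times> X" by (auto simp: pa_orbit_rel_def)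
  show "refl_on X (pa_orbit_rel G X act)"
    using PA3 by (auto simp: refl_on_def pa_orbit_rel_def)
  show "sym (pa_orbit_rel G X act)"
    using PA1 by (fastforce simp: sym_def pa_orbit_rel_def)
  show "trans (pa_orbit_rel G X act)"
    using PA2 by (fastforce simp: trans_def pa_orbit_rel_def)
qed

end

theory Submission
  imports Defs
begin

text \<open>
  Saturations of open sets are open, because each \<open>m\<^sub>g\<close> is an open map between open sets. If two
  \<open>G\<^sub>\<delta>\<close> orbits cannot be separated by a saturated open set, then they have the same closure;
  being dense \<open>G\<^sub>\<delta>\<close> sets in this closed set, they meet by the Baire category theorem. Conversely,
  if the quotient is \<open>T\<^sub>0\<close>, then two points are equivalent iff they lie in the same
  saturations \<open>U\<^sub>n\<close> of basic open sets, so the relation is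
  \<open>\<Inter>n. (U\<^sub>n \<times> U\<^sub>n) \<union> (X - U\<^sub>n) \<times> (X - U\<^sub>n)\<close>, a countable intersection of \<open>G\<^sub>\<delta>\<close> sets.
\<close>

section \<open>Countable bases and G-delta sets\<close>

text \<open>The balls of radius 1/(n+1) around the points of a countable dense set form a countable
  base.\<close>

lemma metrizable_separable_imp_second_countable:
  assumes "metrizable_space X" "separable_space X"
  shows "second_countable X"
proof -
  obtain M d where "Metric_space M d" and Xeq: "X = Metric_space.mtopology M d"
    using assms(1) metrizable_space_def by metis
  interpret Metric_space M d by fact
  obtain C where C: "countable C" "C \<subseteq> M" "mtopology closure_of C = M"
    using assms(2) by (auto simp: separable_space_def Xeq)
  define \<B> where "\<B> = (\<lambda>(c, n). mball c (inverse (Suc n))) ` (C \<times> (UNIV :: nat set))"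
  have "\<exists>V\<in>\<B>. x \<in> V \<and> V \<subseteq> U" if U: "openin mtopology U" "x \<in> U" for U x
  proof -
    obtain r where r: "r > 0" "mball x r \<subseteq> U" and xM: "x \<in> M"
      using U unfolding openin_mtopology by blast
    \<comment> \<open>Half of \<open>r\<close>, because the ball around the nearby dense point
      \<open>c\<close> that contains \<open>x\<close> reaches at most twice its radius away from
      \<open>x\<close>.\<close>
    obtain n where n: "inverse (real (Suc n)) < r / 2"
      using r(1) reals_Archimedean[of "r/2"] by auto
    let ?e = "inverse (real (Suc n))"
    have "x \<in> mtopology closure_of C" using C xM by simp
    then obtain c where c: "c \<in> C" "c \<in> mball x ?e"
      unfolding metric_closure_of by (auto simp del: of_nat_Suc dest: spec[of _ ?e])
    have "mball c ?e \<subseteq> mball x (?e + ?e)"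
    proof
      fix z assume z: "z \<in> mball c ?e"
      then show "z \<in> mball x (?e + ?e)"
        using c(2) triangle[of x c z] by simp
    qed
    then have "mball c ?e \<subseteq> U"
      using n r(2) mball_subset_concentric[of "?e + ?e" r x] by auto
    moreover have "x \<in> mball c ?e"
      using c(2) by (simp add: commute)
    ultimately show ?thesis
      using c(1) by (auto simp: \<B>_def)
  qed
  moreover have "countable \<B>"
    using C(1) by (simp add: \<B>_def)
  moreover have "\<forall>V\<in>\<B>. openin mtopology V"
    by (auto simp: \<B>_def)
  ultimately show ?thesis
    unfolding second_countable_def Xeq by blast
qed

lemma Polish_imp_second_countable: "Polish_space X \<Longrightarrow> second_countable X"
  by (simp add: Polish_space_def completely_metrizable_imp_metrizable_space
      metrizable_separable_imp_second_countable)

text \<open>Preimages commute with countable intersections. The map y \<mapsto> (x, y) will turn a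
  relation into its sections.\<close>

lemma gdelta_in_continuous_map_preimage:
  assumes f: "continuous_map X Y f" and S: "gdelta_in Y S"
  shows "gdelta_in X {x \<in> topspace X. f x \<in> S}"
proof -
  obtain C where C: "\<And>n::nat. openin Y (C n)" and S_eq: "\<Inter>(range C) = S"
    using S gdelta_in_descending by metis
  have "gdelta_in X (\<Inter>n. {x \<in> topspace X. f x \<in> C n})"
    using f C by (intro gdelta_in_Inter) (auto intro: open_imp_gdelta_in openin_continuous_map_preimage)
  also have "(\<Inter>n. {x \<in> topspace X. f x \<in> C n}) = {x \<in> topspace X. f x \<in> S}"
    using S_eq by auto
  finally show ?thesis .
qed

section \<open>Separation in the quotient\<close>

text \<open>Preimage and image under the class map match open sets of the quotient with saturated
  open sets of \<open>X\<close>, so the separation axiom can be tested in \<open>X\<close>.\<close>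

lemma t0_space_quotient_topology_iff:
  assumes R: "equiv (topspace X) R"
  shows "t0_space (quotient_topology X R) \<longleftrightarrow>
    (\<forall>x\<in>topspace X. \<forall>y\<in>topspace X. (x, y) \<notin> R \<longrightarrow>
      (\<exists>U. openin X U \<and> R `` U \<subseteq> U \<and> (x \<in> U \<longleftrightarrow> y \<notin> U)))" (is "_ \<longleftrightarrow> ?rhs")
proof
  assume t0: "t0_space (quotient_topology X R)"
  show ?rhs
  proof (intro ballI impI)
    fix x y assume xy: "x \<in> topspace X" "y \<in> topspace X" "(x, y) \<notin> R"
    then have "R `` {x} \<noteq> R `` {y}"
      using R eq_equiv_class_iff by metis
    then obtain V where V: "openin (quotient_topology X R) V" "R `` {x} \<notin> V \<longleftrightarrow> R `` {y} \<in> V"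
      using t0 xy(1,2) unfolding t0_space_def topspace_quotient_topology by (metis quotientI)
    let ?U = "{z \<in> topspace X. R `` {z} \<in> V}"
    have "R `` ?U \<subseteq> ?U"
      using R equiv_class_eq[OF R] by (auto simp: equiv_def)
    moreover have "openin X ?U"
      using V(1) by (simp add: openin_quotient_topology)
    ultimately show "\<exists>U. openin X U \<and> R `` U \<subseteq> U \<and> (x \<in> U \<longleftrightarrow> y \<notin> U)"
      using V(2) xy by (intro exI[of _ ?U]) auto
  qed
next
  assume rhs: ?rhs
  show "t0_space (quotient_topology X R)"
    unfolding t0_space_def topspace_quotient_topology
  proof (intro ballI impI)
    fix a b assume ab: "a \<in> topspace X // R" "b \<in> topspace X // R" "a \<noteq> b"
    then obtain x y where x: "x \<in> topspace X" "a = R `` {x}" and y: "y \<in> topspace X" "b = R `` {y}"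
      by (auto elim!: quotientE)
    then have "(x, y) \<notin> R"
      using R ab(3) equiv_class_eq by metis
    then obtain U where U: "openin X U" "R `` U \<subseteq> U" "x \<in> U \<longleftrightarrow> y \<notin> U"
      using rhs[rule_format, OF x(1) y(1)] by blast
    \<comment> \<open>Saturation of \<open>U\<close> enters here: the image of \<open>U\<close>
      contains no class of a point outside \<open>U\<close>, so its preimage is \<open>U\<close>
      again.\<close>
    have mem: "R `` {z} \<in> (\<lambda>z. R `` {z}) ` U \<longleftrightarrow> z \<in> U" if "z \<in> topspace X" for z
    proof
      assume "R `` {z} \<in> (\<lambda>z. R `` {z}) ` U"
      then obtain w where "w \<in> U" "R `` {z} = R `` {w}" by auto
      then have "(w, z) \<in> R"
        using R that by (metis eq_equiv_class)
      then show "z \<in> U"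
        using U(2) \<open>w \<in> U\<close> by auto
    qed auto
    have "{z \<in> topspace X. R `` {z} \<in> (\<lambda>z. R `` {z}) ` U} = U"
      using mem openin_subset[OF U(1)] by auto
    then have "openin (quotient_topology X R) ((\<lambda>z. R `` {z}) ` U)"
      using U(1) openin_subset[OF U(1)] by (auto simp: openin_quotient_topology quotientI)
    then show "\<exists>V. openin (quotient_topology X R) V \<and> (a \<notin> V \<longleftrightarrow> b \<in> V)"
      using mem x y U(3) by metis
  qed
qed

section \<open>From G-delta classes to a T0 quotient by Baire category\<close>

text \<open>Open sets whose intersection is dense are themselves dense. The families for
  \<open>A\<close> and \<open>B\<close> together are still countable, so by Baire
  \<open>A \<inter> B\<close> is dense.\<close>

lemma dense_gdelta_Int_nonempty:
  assumes X: "completely_metrizable_space X" and "topspace X \<noteq> {}"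
    and A: "gdelta_in X A" "X closure_of A = topspace X"
    and B: "gdelta_in X B" "X closure_of B = topspace X"
  shows "A \<inter> B \<noteq> {}"
proof -
  have "\<exists>\<G>. countable \<G> \<and> \<Inter>\<G> = S \<and> (\<forall>T\<in>\<G>. openin X T \<and> X closure_of T = topspace X)"
    if S: "gdelta_in X S" "X closure_of S = topspace X" for S
  proof -
    obtain C where C: "\<And>n::nat. openin X (C n)" and S_eq: "\<Inter>(range C) = S"
      using S(1) gdelta_in_descending by metis
    then have "X closure_of C n = topspace X" for n
      using S(2) closure_of_mono[of S "C n" X] closure_of_subset_topspace[of X "C n"] by auto
    with C S_eq show ?thesis
      by (intro exI[of _ "range C"]) auto
  qed
  then obtain \<G> \<H> where "countable \<G>" "\<Inter>\<G> = A" "countable \<H>" "\<Inter>\<H> = B"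
    "\<forall>T\<in>\<G> \<union> \<H>. openin X T \<and> X closure_of T = topspace X"
    using A B by (metis UnE)
  then have "X closure_of (A \<inter> B) = topspace X"
    using Baire_category[of X "\<G> \<union> \<H>"] X by (auto simp: Inter_Un_distrib)
  with \<open>topspace X \<noteq> {}\<close> show ?thesis by (metis closure_of_empty)
qed

text \<open>The action enters only through the openness of saturations, so the argument is run for a
  general equivalence relation.\<close>

lemma gdelta_classes_imp_t0_quotient:
  assumes X: "completely_metrizable_space X" and R: "equiv (topspace X) R"
    and sat: "\<And>U. openin X U \<Longrightarrow> openin X (R `` U)"
    and gdelta: "\<And>x. x \<in> topspace X \<Longrightarrow> gdelta_in X (R `` {x})"
  shows "t0_space (quotient_topology X R)"
  unfolding t0_space_quotient_topology_iff[OF R]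
proof (intro ballI impI)
  fix x y assume x: "x \<in> topspace X" and y: "y \<in> topspace X" and "(x, y) \<notin> R"
  have sym: "(b, a) \<in> R" if "(a, b) \<in> R" for a b
    using R that by (auto simp: equiv_def dest: symD)
  have trans: "(a, c) \<in> R" if "(a, b) \<in> R" "(b, c) \<in> R" for a b c
    using R that by (auto simp: equiv_def dest: transD)
  have sub: "R `` {a} \<subseteq> topspace X" for a
    using R by (auto simp: equiv_def)
  show "\<exists>U. openin X U \<and> R `` U \<subseteq> U \<and> (x \<in> U \<longleftrightarrow> y \<notin> U)"
  proof (rule ccontr)
    assume "\<not> ?thesis"
    then have insep: "x \<in> U \<longleftrightarrow> y \<in> U" if "openin X U" "R `` U \<subseteq> U" for U
      using that by blast
    \<comment> \<open>A neighbourhood of a point in the class of \<open>a\<close> has an open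
      saturation containing \<open>a\<close>, hence \<open>b\<close>; so the neighbourhood meets the
      class of \<open>b\<close>. The one-sided premise allows use in both directions.\<close>
    have class_subset: "R `` {a} \<subseteq> X closure_of (R `` {b})"
      if ab: "\<And>U. openin X U \<Longrightarrow> R `` U \<subseteq> U \<Longrightarrow> a \<in> U \<Longrightarrow> b \<in> U" for a b
    proof
      fix z assume z: "z \<in> R `` {a}"
      have "\<exists>w\<in>R `` {b}. w \<in> U" if U: "z \<in> U" "openin X U" for U
      proof -
        have "a \<in> R `` U" using z U(1) sym by auto
        moreover have "R `` (R `` U) \<subseteq> R `` U" using trans by blast
        ultimately have "b \<in> R `` U" using ab sat U(2) by blast
        then show ?thesis using sym by auto
      qed
      with z sub show "z \<in> X closure_of (R `` {b})"
        unfolding in_closure_of by blast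
    qed
    \<comment> \<open>Both classes have closure \<open>C\<close>. Being closed, \<open>C\<close> is
      completely metrizable, and the category argument takes place in it, where both classes are
      dense.\<close>
    define C where "C = X closure_of (R `` {x})"
    have "R `` {x} \<subseteq> X closure_of (R `` {y})" "R `` {y} \<subseteq> X closure_of (R `` {x})"
      using class_subset insep by blast+
    then have C_eq: "C = X closure_of (R `` {y})"
      unfolding C_def by (simp add: closure_of_minimal subset_antisym)
    have C_sub: "R `` {x} \<subseteq> C" "R `` {y} \<subseteq> C"
      using closure_of_subset[OF sub] C_def C_eq by auto
    have "C \<subseteq> topspace X"
      by (simp add: C_def closure_of_subset_topspace)
    then have topspace_C: "topspace (subtopology X C) = C"
      by (simp add: Int_absorb1)
    have dense: "subtopology X C closure_of S = topspace (subtopology X C)"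
      if "X closure_of S = C" "S \<subseteq> C" for S
      unfolding topspace_C using that by (simp add: closure_of_subtopology Int_absorb1)
    have gd: "gdelta_in (subtopology X C) (R `` {a})"
      if "a \<in> topspace X" "R `` {a} \<subseteq> C" for a
      using gdelta[OF that(1)] that(2) by (auto simp: gdelta_in_subtopology)
    have "x \<in> R `` {x}"
      using R x by (auto simp: equiv_def refl_on_def)
    with C_sub have "topspace (subtopology X C) \<noteq> {}" unfolding topspace_C by auto
    moreover have "completely_metrizable_space (subtopology X C)"
      using X by (simp add: C_def completely_metrizable_space_closedin)
    ultimately have "R `` {x} \<inter> R `` {y} \<noteq> {}"
      using dense_gdelta_Int_nonempty gd dense C_sub x y C_def C_eq by metis
    then show False
      using \<open>(x, y) \<notin> R\<close> sym trans by blast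
  qed
qed

section \<open>From a T0 quotient to a G-delta relation\<close>

lemma t0_quotient_imp_gdelta_rel:
  assumes X: "second_countable X" "metrizable_space X" and R: "equiv (topspace X) R"
    and sat: "\<And>U. openin X U \<Longrightarrow> openin X (R `` U)"
    and t0: "t0_space (quotient_topology X R)"
  shows "gdelta_in (prod_topology X X) R"
proof -
  have sym: "(b, a) \<in> R" if "(a, b) \<in> R" for a b
    using R that by (auto simp: equiv_def dest: symD)
  have trans: "(a, c) \<in> R" if "(a, b) \<in> R" "(b, c) \<in> R" for a b c
    using R that by (auto simp: equiv_def dest: transD)
  have refl: "(a, a) \<in> R" if "a \<in> topspace X" for a
    using R that by (auto simp: equiv_def refl_on_def)
  have sub: "R \<subseteq> topspace X \<times> topspace X"
    using R by (simp add: equiv_def)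
  obtain \<B> where \<B>: "countable \<B>" "\<And>V. V \<in> \<B> \<Longrightarrow> openin X V"
    and base: "\<And>U x. openin X U \<Longrightarrow> x \<in> U \<Longrightarrow> \<exists>V\<in>\<B>. x \<in> V \<and> V \<subseteq> U"
    using X(1) unfolding second_countable_def by metis
  \<comment> \<open>\<open>D V\<close> consists of the pairs of points that the saturation of
    \<open>V\<close> does not separate.\<close>
  define D where
    "D V = (R `` V) \<times> (R `` V) \<union> (topspace X - R `` V) \<times> (topspace X - R `` V)" for V
  \<comment> \<open>The full square keeps the family nonempty and its intersection within the square
    even when \<open>\<B>\<close> is empty.\<close>
  have "gdelta_in (prod_topology X X) (\<Inter>(insert (topspace X \<times> topspace X) (D ` \<B>)))"
  proof (rule gdelta_in_Inter)
    fix S assume "S \<in> insert (topspace X \<times> topspace X) (D ` \<B>)"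
    then consider "S = topspace X \<times> topspace X" | V where "V \<in> \<B>" "S = D V" by auto
    then show "gdelta_in (prod_topology X X) S"
    proof cases
      case 1
      then show ?thesis
        using gdelta_in_topspace[of "prod_topology X X"] by simp
    next
      case 2
      have op: "openin X (R `` V)" using sat \<B>(2) 2 by blast
      have "openin (prod_topology X X) ((R `` V) \<times> (R `` V))"
        using op by (simp add: openin_prod_Times_iff)
      moreover have "closedin (prod_topology X X) ((topspace X - R `` V) \<times> (topspace X - R `` V))"
        using op by (simp add: closedin_prod_Times_iff closedin_diff)
      \<comment> \<open>Closed sets of a metrizable space are G-delta, which covers the second
        square in \<open>D V\<close>.\<close>
      moreover have "metrizable_space (prod_topology X X)"
        using X(2) by (simp add: metrizable_space_prod_topology)
      ultimately show ?thesis
        unfolding 2 D_def by (intro gdelta_in_Un open_imp_gdelta_in closed_imp_gdelta_in)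
    qed
  qed (use \<B> in auto)
  also have "\<Inter>(insert (topspace X \<times> topspace X) (D ` \<B>)) = R"
  proof (rule subset_antisym)
    show "R \<subseteq> \<Inter>(insert (topspace X \<times> topspace X) (D ` \<B>))"
      using sub sym trans unfolding D_def by blast
  next
    \<comment> \<open>A basic \<open>V\<close> with \<open>a\<close> in \<open>V\<close> and
      \<open>V \<subseteq> U\<close> has its saturation inside the saturated set \<open>U\<close>,
      so it already separates \<open>a\<close> from \<open>b\<close>. Thus countably many
      saturations suffice.\<close>
    have sep: False
      if U: "openin X U" "R `` U \<subseteq> U" and ab: "a \<in> U" "b \<notin> U"
        and D: "\<And>V. V \<in> \<B> \<Longrightarrow> a \<in> R `` V \<longleftrightarrow> b \<in> R `` V" for U a b
    proof -
      obtain V where V: "V \<in> \<B>" "a \<in> V" "V \<subseteq> U" using base[OF U(1) ab(1)] by blast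
      then have "a \<in> R `` V" using refl openin_subset[OF U(1)] by blast
      then show False using D V U(2) ab(2) by blast
    qed
    have "(x, y) \<in> R" if xy: "x \<in> topspace X" "y \<in> topspace X" "\<And>V. V \<in> \<B> \<Longrightarrow> (x, y) \<in> D V" for x y
    proof (rule ccontr)
      assume "(x, y) \<notin> R"
      then obtain U where U: "openin X U" "R `` U \<subseteq> U" "x \<in> U \<longleftrightarrow> y \<notin> U"
        using t0[unfolded t0_space_quotient_topology_iff[OF R], rule_format, OF xy(1,2)] by metis
      have D: "x \<in> R `` V \<longleftrightarrow> y \<in> R `` V" if "V \<in> \<B>" for V
        using xy(3)[OF that] by (auto simp: D_def)
      show False
        using sep[OF U(1,2) _ _ D] sep[OF U(1,2) _ _ D[symmetric]] U(3) by metis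
    qed
    then show "\<Inter>(insert (topspace X \<times> topspace X) (D ` \<B>)) \<subseteq> R"
      by auto
  qed
  finally show ?thesis .
qed

section \<open>Application to partial actions\<close>

lemma (in partial_action) pa_orbit_eq_class: "pa_orbit G act x = pa_orbit_rel G X act `` {x}"
  using act_carrier by (force simp: pa_orbit_def pa_elements_def pa_orbit_rel_def)

lemma (in continuous_partial_action) openin_saturation:
  assumes U: "openin X U"
  shows "openin X (pa_orbit_rel G (topspace X) act `` U)"
proof -
  \<comment> \<open>\<open>pa_set G act (inv g)\<close> is the domain of \<open>g\<close>, since
    \<open>inv (inv g)\<close> is \<open>g\<close>; the union therefore collects the images of the
    parts of \<open>U\<close> on which each \<open>g\<close> acts.\<close>
  have "pa_orbit_rel G (topspace X) act `` U =
    (\<Union>g\<in>carrier G. (\<lambda>x. the (act g x)) ` (U \<inter> pa_set G act (inv g)))" (is "?L = ?R")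
  proof
    show "?L \<subseteq> ?R"
      by (force simp: pa_orbit_rel_def pa_set_def)
    show "?R \<subseteq> ?L"
      using act_carrier by (fastforce simp: pa_orbit_rel_def pa_set_def)
  qed
  moreover have "openin X ((\<lambda>x. the (act g x)) ` (U \<inter> pa_set G act (inv g)))"
    if g: "g \<in> carrier G" for g
  proof -
    have "openin (subtopology X (pa_set G act (inv g))) (U \<inter> pa_set G act (inv g))"
      using U by (rule openin_subtopology_Int)
    then have "openin (subtopology X (pa_set G act g))
        ((\<lambda>x. the (act g x)) ` (U \<inter> pa_set G act (inv g)))"
      using homeomorphic_imp_open_map[OF homeomorphic_act[OF g]] by (simp add: open_map_def)
    then show ?thesis
      using open_pa_set[OF g] openin_trans_full by blast
  qed
  ultimately show ?thesis by auto
qed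

theorem theorem4p2:
  fixes G :: "('g, 'm) monoid_scheme"
    and T :: "'g topology"
    and X :: "'x topology"
    and act :: "'g \<Rightarrow> 'x \<rightharpoonup> 'x"
  assumes "polish_group G T"
    and "Polish_space X"
    and "continuous_partial_action G T X act"
  shows "(gdelta_in (prod_topology X X) (pa_orbit_rel G (topspace X) act) \<longleftrightarrow>
            (\<forall>x \<in> topspace X. gdelta_in X (pa_orbit G act x))) \<and>
         ((\<forall>x \<in> topspace X. gdelta_in X (pa_orbit G act x)) \<longleftrightarrow>
            t0_space (quotient_topology X (pa_orbit_rel G (topspace X) act)))"
proof -
  interpret continuous_partial_action G T X act by fact
  define R where "R = pa_orbit_rel G (topspace X) act"
  have R: "equiv (topspace X) R"
    unfolding R_def by (rule equiv_pa_orbit_rel)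
  have sat: "openin X (R `` U)" if "openin X U" for U
    unfolding R_def using that by (rule openin_saturation)
  have X: "completely_metrizable_space X"
    using assms(2) by (simp add: Polish_space_def)
  \<comment> \<open>The implications are proved as a cycle (1) to (2) to (3) to (1). The first holds
    because a class is a section of \<open>R\<close>.\<close>
  have "gdelta_in X (R `` {x})" if "gdelta_in (prod_topology X X) R" "x \<in> topspace X" for x
  proof -
    have "continuous_map X (prod_topology X X) (\<lambda>y. (x, y))"
      using that(2) by (simp add: continuous_map_pairwise o_def)
    from gdelta_in_continuous_map_preimage[OF this that(1)]
    have "gdelta_in X {y \<in> topspace X. (x, y) \<in> R}" .
    moreover have "{y \<in> topspace X. (x, y) \<in> R} = R `` {x}"
      using R by (auto simp: equiv_def)
    ultimately show ?thesis by simp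
  qed
  moreover have "t0_space (quotient_topology X R)" if "\<forall>x\<in>topspace X. gdelta_in X (R `` {x})"
    using gdelta_classes_imp_t0_quotient[OF X R sat] that by blast
  moreover have "gdelta_in (prod_topology X X) R" if "t0_space (quotient_topology X R)"
    using t0_quotient_imp_gdelta_rel[OF Polish_imp_second_countable[OF assms(2)]
        completely_metrizable_imp_metrizable_space[OF X] R sat that] .
  ultimately show ?thesis
    unfolding pa_orbit_eq_class R_def[symmetric] by blast
qed

end
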